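(* Let $L$ be the Laplacian matrix of an undirected graph on $n$ nodes, let $\mathcal{C}\subseteq\mathbb{R}^n$ be a linear subspace of dimension $k$, and let $P\in\mathbb{R}^{n\times k}$ be a normalized partition matrix. Write $\|x\|_L=\sqrt{x^TLx}$ for $x\in\mathbb{R}^n$. Suppose that $$\max_{y\in\mathcal{C},\ \|y\|_L\neq 0}\ \frac{\|y-PP^Ty\|_L}{\|y\|_L}\le\varepsilon<1 .$$ Then for any $y\in\mathcal{C}$ there exists $x\in\mathbb{R}^k$ such that $$\left|\,y^TLy-x^TP^TLPx\,\right|\le 3\varepsilon\,\|y\|_L^2 .$$
   Context: The Laplacian of a graph with adjacency matrix $A\in\{0,1\}^{n\times n}$ and diagonal degree matrix $D$ is $L=D-A$; it is positive semidefinite, so $\|\cdot\|_L$ is a seminorm. A normalized partition matrix of size $n\times k$ is a matrix $P\in\mathbb{R}^{n\times k}$ arising from a partition of $\{1,\dots,n\}$ into $k$ disjoint nonempty clusters $C_1,\dots,C_k$ covering $\{1,\dots,n\}$ via $P_{ij}=1/\sqrt{|C_j|}$ if $i\in C_j$ and $P_{ij}=0$ otherwise; in particular $P^TP=I$. The hypothesis means that $\|y-PP^Ty\|_L\le\varepsilon\|y\|_L$ for every $y\in\mathcal{C}$ with $\|y\|_L\ne 0$. *)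

theory Defs
  imports "HOL-Analysis.Analysis"
begin

text \<open>The diagonal is not required to vanish: loops cancel in the Laplacian below, so simple
  graphs are a special case.\<close>
definition undirected_adjacency :: "real ^ 'n ^ 'n \<Rightarrow> bool" where
  "undirected_adjacency A \<longleftrightarrow> (\<forall>i j. A $ i $ j \<in> {0, 1}) \<and> transpose A = A"

definition degree_matrix :: "real ^ 'n ^ 'n \<Rightarrow> real ^ 'n ^ 'n" where
  "degree_matrix A = (\<chi> i j. if i = j then \<Sum>l\<in>UNIV. A $ i $ l else 0)"

definition laplacian :: "real ^ 'n ^ 'n \<Rightarrow> real ^ 'n ^ 'n" where
  "laplacian A = degree_matrix A - A"

definition mat_seminorm :: "real ^ 'n ^ 'n \<Rightarrow> real ^ 'n \<Rightarrow> real" where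
  "mat_seminorm L x = sqrt (x \<bullet> (L *v x))"

definition normalized_partition_matrix :: "real ^ 'k ^ 'n \<Rightarrow> bool" where
  "normalized_partition_matrix P \<longleftrightarrow>
     (\<exists>Cl :: 'k \<Rightarrow> 'n set.
        disjoint_family Cl \<and> (\<forall>j. Cl j \<noteq> {}) \<and> (\<Union>j. Cl j) = UNIV \<and>
        P = (\<chi> i j. if i \<in> Cl j then 1 / sqrt (real (card (Cl j))) else 0))"

end

theory Submission
  imports Defs
begin

text \<open>
  The Laplacian form is \<open>\<Sum>i j. A i j (x i - x j)\<^sup>2 / 2\<close>, so \<open>\<parallel>\<cdot>\<parallel>\<^sub>L\<close> satisfies the triangle inequality.
  Take \<open>x = P\<^sup>T y\<close> and \<open>z = P P\<^sup>T y\<close>. Then \<open>\<bar>\<parallel>y\<parallel>\<^sub>L - \<parallel>z\<parallel>\<^sub>L\<bar> \<le> \<epsilon> \<parallel>y\<parallel>\<^sub>L\<close> and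
  \<open>\<parallel>y\<parallel>\<^sub>L + \<parallel>z\<parallel>\<^sub>L \<le> (2 + \<epsilon>) \<parallel>y\<parallel>\<^sub>L\<close>, and the difference of squares is at most
  \<open>\<epsilon> (2 + \<epsilon>) \<parallel>y\<parallel>\<^sub>L\<^sup>2 \<le> 3 \<epsilon> \<parallel>y\<parallel>\<^sub>L\<^sup>2\<close>. If \<open>\<parallel>y\<parallel>\<^sub>L = 0\<close> the hypothesis says nothing, and \<open>x = 0\<close> works.
\<close>

text \<open>The degree is a row sum, so entry i of L x is the sum over j of A i j (x i - x j). Pair
  this with x and average with the copy where i and j are exchanged: by symmetry of A the factor x i
  becomes (x i - x j) / 2.\<close>

lemma laplacian_quadratic_form:
  fixes A :: "real ^ 'n ^ 'n"
  assumes "transpose A = A"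
  shows "x \<bullet> (laplacian A *v x) = (\<Sum>i\<in>UNIV. \<Sum>j\<in>UNIV. A $ i $ j * (x $ i - x $ j)\<^sup>2) / 2"
proof -
  have sym: "A $ j $ i = A $ i $ j" for i j
    using arg_cong[OF assms, of "\<lambda>M. M $ i $ j"] by (simp add: transpose_def)
  have Lx: "(laplacian A *v x) $ i = (\<Sum>j\<in>UNIV. A $ i $ j * (x $ i - x $ j))" for i
    by (simp add: laplacian_def degree_matrix_def matrix_vector_mult_def left_diff_distrib
        right_diff_distrib sum_subtractf sum_distrib_right if_distrib[of "\<lambda>a. a * _"] cong: if_cong)
  define S where "S = (\<Sum>i\<in>UNIV. \<Sum>j\<in>UNIV. A $ i $ j * (x $ i - x $ j) * x $ i)"
  have "x \<bullet> (laplacian A *v x) = S"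
    by (simp add: S_def inner_vec_def Lx sum_distrib_left mult_ac)
  moreover have swap: "S = (\<Sum>i\<in>UNIV. \<Sum>j\<in>UNIV. - (A $ i $ j * (x $ i - x $ j) * x $ j))"
    unfolding S_def by (subst sum.swap) (intro sum.cong refl, simp add: sym algebra_simps)
  have "S + S = (\<Sum>i\<in>UNIV. \<Sum>j\<in>UNIV. A $ i $ j * (x $ i - x $ j)\<^sup>2)"
    by (subst (2) swap, unfold S_def, simp only: sum.distrib[symmetric])
      (intro sum.cong refl, simp add: power2_eq_square algebra_simps)
  ultimately show ?thesis by simp
qed

text \<open>Nonnegative weights have square roots, so the quadratic form is a sum of squares over
  ordered pairs. Nonnegativity and the triangle inequality are then inherited from
  \<open>L2_set\<close>.\<close>

lemma mat_seminorm_laplacian_eq_L2_set: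
  fixes A :: "real ^ 'n ^ 'n"
  assumes "undirected_adjacency A"
  shows "mat_seminorm (laplacian A) x =
    L2_set (\<lambda>(i, j). sqrt (A $ i $ j / 2) * (x $ i - x $ j)) (UNIV \<times> UNIV)"
proof -
  have tr: "transpose A = A"
    using assms by (simp add: undirected_adjacency_def)
  have "A $ i $ j \<ge> 0" for i j
    using assms unfolding undirected_adjacency_def
    by (metis empty_iff insert_iff order_refl zero_le_one)
  then show ?thesis
    by (simp add: mat_seminorm_def L2_set_def laplacian_quadratic_form[OF tr]
        sum.cartesian_product case_prod_unfold power_mult_distrib sum_divide_distrib
        del: UNIV_Times_UNIV)
qed

lemma mat_seminorm_laplacian_triangle:
  assumes "undirected_adjacency A"
  shows "mat_seminorm (laplacian A) (x + y) \<le>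
    mat_seminorm (laplacian A) x + mat_seminorm (laplacian A) y"
proof -
  have "(\<lambda>(i, j). sqrt (A $ i $ j / 2) * ((x + y) $ i - (x + y) $ j)) =
    (\<lambda>p. (case p of (i, j) \<Rightarrow> sqrt (A $ i $ j / 2) * (x $ i - x $ j)) +
         (case p of (i, j) \<Rightarrow> sqrt (A $ i $ j / 2) * (y $ i - y $ j)))"
    by (auto simp: algebra_simps)
  then show ?thesis
    unfolding mat_seminorm_laplacian_eq_L2_set[OF assms] by (simp only: L2_set_triangle_ineq)
qed

lemma mat_seminorm_minus: "mat_seminorm L (- x) = mat_seminorm L x"
  using matrix_vector_mult_diff_distrib[of L 0 x] by (simp add: mat_seminorm_def)

lemma mat_seminorm_laplacian_nonneg:
  assumes "undirected_adjacency A"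
  shows "mat_seminorm (laplacian A) x \<ge> 0"
  by (simp add: mat_seminorm_laplacian_eq_L2_set[OF assms])

lemma mat_seminorm_laplacian_square:
  assumes "undirected_adjacency A"
  shows "(mat_seminorm (laplacian A) x)\<^sup>2 = x \<bullet> (laplacian A *v x)"
  using mat_seminorm_laplacian_nonneg[OF assms, of x] by (simp add: mat_seminorm_def)

theorem theorem4p5:
  fixes A L :: "real ^ 'n ^ 'n" and C :: "(real ^ 'n) set"
    and P :: "real ^ 'k ^ 'n" and \<epsilon> :: real
  assumes "undirected_adjacency A"
    and "L = laplacian A"
    and "subspace C"
    and "dim C = CARD('k)"
    and "normalized_partition_matrix P"
    and "\<forall>y\<in>C. mat_seminorm L y \<noteq> 0 \<longrightarrow>
           mat_seminorm L (y - (P ** transpose P) *v y) / mat_seminorm L y \<le> \<epsilon>"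
    and "\<epsilon> < 1"
  shows "\<forall>y\<in>C. \<exists>x :: real ^ 'k.
           \<bar>y \<bullet> (L *v y) - x \<bullet> ((transpose P ** L ** P) *v x)\<bar> \<le> 3 * \<epsilon> * (mat_seminorm L y)\<^sup>2"
proof
  fix y assume "y \<in> C"
  let ?N = "mat_seminorm L"
  have square: "v \<bullet> (L *v v) = (?N v)\<^sup>2" for v
    using mat_seminorm_laplacian_square[OF assms(1)] assms(2) by simp
  have nonneg: "?N v \<ge> 0" for v
    using mat_seminorm_laplacian_nonneg[OF assms(1)] assms(2) by simp
  have triangle: "?N (u + v) \<le> ?N u + ?N v" for u v
    using mat_seminorm_laplacian_triangle[OF assms(1)] assms(2) by simp
  show "\<exists>x :: real ^ 'k. \<bar>y \<bullet> (L *v y) - x \<bullet> ((transpose P ** L ** P) *v x)\<bar> \<le> 3 * \<epsilon> * (?N y)\<^sup>2"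
  proof (cases "?N y = 0")
    case True
    \<comment> \<open>Both sides vanish, whatever the sign of \<epsilon>.\<close>
    then show ?thesis
      by (intro exI[of _ 0]) (simp add: square)
  next
    case False
    then have pos: "?N y > 0"
      using nonneg[of y] by simp
    define x where "x = transpose P *v y"
    define z where "z = P *v x"
    have z: "(P ** transpose P) *v y = z"
      by (simp only: z_def x_def matrix_vector_mul_assoc)
    have "?N (y - z) / ?N y \<le> \<epsilon>"
      using assms(6) \<open>y \<in> C\<close> False z by auto
    then have d: "?N (y - z) \<le> \<epsilon> * ?N y"
      using pos by (simp add: pos_divide_le_eq)
    \<comment> \<open>The bound itself forces this sign, as \<open>?N y\<close> is positive;
      multiplying the estimates below relies on it.\<close>
    then have eps: "\<epsilon> \<ge> 0"
      using nonneg[of "y - z"] pos by (metis order_trans zero_le_mult_iff not_less)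
    \<comment> \<open>Split y = z + (y - z) and z = y + (z - y).\<close>
    have "?N y \<le> ?N z + ?N (y - z)" "?N z \<le> ?N y + ?N (y - z)"
      using triangle[of z "y - z"] triangle[of y "z - y"] mat_seminorm_minus[of L "y - z"] by auto
    then have diff: "\<bar>?N y - ?N z\<bar> \<le> \<epsilon> * ?N y" and sum: "?N y + ?N z \<le> (2 + \<epsilon>) * ?N y"
      using d by (auto simp: algebra_simps)
    have "x \<bullet> ((transpose P ** L ** P) *v x) = x \<bullet> (transpose P *v (L *v z))"
      by (simp only: z_def matrix_vector_mul_assoc matrix_mul_assoc)
    \<comment> \<open>Moving the transpose across the inner product turns x into P x = z.\<close>
    also have "\<dots> = (?N z)\<^sup>2"
      by (simp only: dot_lmul_matrix[symmetric] vector_transpose_matrix square[symmetric] z_def)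
    finally have "x \<bullet> ((transpose P ** L ** P) *v x) = (?N z)\<^sup>2" .
    then have "\<bar>y \<bullet> (L *v y) - x \<bullet> ((transpose P ** L ** P) *v x)\<bar> = \<bar>?N y - ?N z\<bar> * (?N y + ?N z)"
      using nonneg[of y] nonneg[of z] by (simp add: square power2_eq_square square_diff_square_factored abs_mult)
    also have "\<dots> \<le> (\<epsilon> * ?N y) * ((2 + \<epsilon>) * ?N y)"
      using diff sum eps nonneg[of y] nonneg[of z] by (intro mult_mono) auto
    also have "\<dots> = (2 + \<epsilon>) * (\<epsilon> * (?N y)\<^sup>2)"
      by (simp add: power2_eq_square)
    \<comment> \<open>Here \<epsilon> < 1 enters, through 2 + \<epsilon> \<le> 3.\<close>
    also have "\<dots> \<le> 3 * (\<epsilon> * (?N y)\<^sup>2)"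
      using eps assms(7) by (intro mult_right_mono) auto
    finally show ?thesis
      by (auto simp: mult.assoc)
  qed
qed

end
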